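(* Let $w_1,w_2,d\in\mathbb{N}$ with $w_1\equiv w_2\equiv d\equiv 1 \pmod 2$, let $\chi$ be a Dirichlet character with conductor $d$, and let $\lambda\neq 0$ be a parameter. Then for every integer $l\ge 0$, \[ \sum_{i=0}^{l}\binom{l}{i}\mathcal{E}_{i,\frac{\lambda}{w_{1}},\chi}(w_{2}x)\,w_{1}^{i}w_{2}^{l-i}\,R_{l-i}\!\left(dw_{1}-1,\tfrac{\lambda}{w_{2}}\,\middle|\,\chi\right) =\sum_{i=0}^{l}\binom{l}{i}\mathcal{E}_{i,\frac{\lambda}{w_{2}},\chi}(w_{1}x)\,w_{2}^{i}w_{1}^{l-i}\,R_{l-i}\!\left(dw_{2}-1,\tfrac{\lambda}{w_{1}}\,\middle|\,\chi\right). \]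
   Context: For $d\in\mathbb{N}$ odd, a Dirichlet character $\chi$ with conductor $d$, and a nonzero parameter $\mu$, the generalized degenerate Euler polynomials $\mathcal{E}_{n,\mu,\chi}(x)$ attached to $\chi$ are defined by the generating function (formal power series in $t$) \[ \frac{2\sum_{a=0}^{d-1}(-1)^{a}\chi(a)(1+\mu t)^{a/\mu}}{(1+\mu t)^{d/\mu}+1}\,(1+\mu t)^{x/\mu}=\sum_{n=0}^{\infty}\mathcal{E}_{n,\mu,\chi}(x)\frac{t^{n}}{n!}. \] The degenerate falling factorial is $(x\mid\mu)_0=1$ and $(x\mid\mu)_k=x(x-\mu)\cdots(x-(k-1)\mu)$ for $k\ge1$. For integers $n,k\ge 0$, $R_k(n,\mu\mid\chi)=2\sum_{l=0}^{n}(-1)^{l}\chi(l)\,(l\mid\mu)_k$. *)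

theory Defs
  imports
    "HOL-Number_Theory.Cong"
    "HOL-Computational_Algebra.Formal_Power_Series"
begin

text \<open>
  The source leaves the domain of the character values, of the parameters and of the polynomial
  argument open, so everything is over an arbitrary field of characteristic 0 (for example
  the complex numbers).
\<close>

definition dirichlet_character :: "nat \<Rightarrow> (int \<Rightarrow> 'a::field_char_0) \<Rightarrow> bool" where
  "dirichlet_character m \<chi> \<longleftrightarrow>
     m > 0 \<and>
     \<chi> 1 = 1 \<and>
     (\<forall>a b. \<chi> (a * b) = \<chi> a * \<chi> b) \<and>
     (\<forall>a b. [a = b] (mod int m) \<longrightarrow> \<chi> a = \<chi> b) \<and>
     (\<forall>a. \<chi> a \<noteq> 0 \<longleftrightarrow> coprime a (int m))"

text \<open>
  The conductor of a character \<open>\<chi>\<close> modulo \<open>m\<close> is the least divisor \<open>c\<close> of \<open>m\<close> such that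
  \<open>\<chi>\<close> is induced by a character modulo \<open>c\<close>. A character modulo \<open>d\<close> has conductor \<open>d\<close> iff
  it is primitive.
\<close>

definition conductor :: "nat \<Rightarrow> (int \<Rightarrow> 'a::field_char_0) \<Rightarrow> nat" where
  "conductor m \<chi> = (LEAST c. c dvd m \<and>
     (\<exists>\<psi> :: int \<Rightarrow> 'a. dirichlet_character c \<psi> \<and>
        (\<forall>a. coprime a (int m) \<longrightarrow> \<chi> a = \<psi> a)))"

text \<open>The formal power series $(1 + \mu t)^{c/\mu}$ in $t$, by the binomial series.\<close>

definition degenerate_exp :: "'a::field_char_0 \<Rightarrow> 'a \<Rightarrow> 'a fps" where
  "degenerate_exp \<mu> c = fps_binomial (c / \<mu>) oo (fps_const \<mu> * fps_X)"

definition degenerate_euler_gf ::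
    "nat \<Rightarrow> 'a::field_char_0 \<Rightarrow> (int \<Rightarrow> 'a) \<Rightarrow> 'a \<Rightarrow> 'a fps" where
  "degenerate_euler_gf d \<mu> \<chi> x =
     (2 * (\<Sum>a<d. (- 1) ^ a * fps_const (\<chi> (int a)) * degenerate_exp \<mu> (of_nat a)))
       / (degenerate_exp \<mu> (of_nat d) + 1)
     * degenerate_exp \<mu> x"

text \<open>The value at \<open>x\<close> of the \<open>n\<close>-th polynomial; \<open>d\<close> is the conductor of \<open>\<chi>\<close>.\<close>

definition degenerate_euler ::
    "nat \<Rightarrow> nat \<Rightarrow> 'a::field_char_0 \<Rightarrow> (int \<Rightarrow> 'a) \<Rightarrow> 'a \<Rightarrow> 'a" where
  "degenerate_euler d n \<mu> \<chi> x = fact n * fps_nth (degenerate_euler_gf d \<mu> \<chi> x) n"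

definition degenerate_ff :: "'a::field_char_0 \<Rightarrow> 'a \<Rightarrow> nat \<Rightarrow> 'a" where
  "degenerate_ff x \<mu> k = (\<Prod>i<k. x - of_nat i * \<mu>)"

definition alt_char_sum ::
    "nat \<Rightarrow> nat \<Rightarrow> 'a::field_char_0 \<Rightarrow> (int \<Rightarrow> 'a) \<Rightarrow> 'a" where
  "alt_char_sum k n \<mu> \<chi> =
     2 * (\<Sum>l=0..n. (- 1) ^ l * \<chi> (int l) * degenerate_ff (of_nat l) \<mu> k)"

end

theory Submission imports Defs begin

text \<open>
  Write $E(c) = (1 + \lambda t)^{c/\lambda}$ and $T_w(N) = \sum_{a<N} (-1)^a \chi(a) E(wa)$.
  Up to the factor $1/l!$, the left-hand side is the $l$-th coefficient of the product of the
  generating function of the Euler polynomials with parameter $\lambda/w_1$, taken at $w_1 t$,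
  and of $2 T_{w_2}(dw_1)$, that is, of
  \[
    \frac{2 T_{w_1}(d)}{E(dw_1) + 1} E(w_1 w_2 x) \cdot 2 T_{w_2}(d w_1).
  \]
  Since $\chi$ has period $d$ and $d$, $w_1$ are odd, a geometric sum gives
  $T_{w_2}(d w_1) (E(dw_2) + 1) = T_{w_2}(d) (E(d w_1 w_2) + 1)$, which makes the product
  symmetric in $w_1$ and $w_2$.
\<close>

text \<open>Presents the sign as a constant series, the form that composition and coefficient
  extraction handle.\<close>

lemma minus_one_power_fps: "(- 1) ^ n = (fps_const ((- 1) ^ n) :: 'a::comm_ring_1 fps)"
  by (induction n) simp_all

lemma degenerate_exp_add:
  "degenerate_exp \<mu> (a + b) = degenerate_exp \<mu> a * degenerate_exp \<mu> b"
  by (simp add: degenerate_exp_def add_divide_distrib fps_binomial_add_mult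
      fps_compose_mult_distrib)

lemma degenerate_exp_0 [simp]: "degenerate_exp \<mu> 0 = 1"
  by (simp add: degenerate_exp_def)

lemma degenerate_exp_of_nat_mult:
  "degenerate_exp \<mu> (of_nat n * c) = degenerate_exp \<mu> c ^ n"
  by (induction n) (simp_all add: degenerate_exp_add distrib_right)

lemma fps_nth_degenerate_exp:
  "fps_nth (degenerate_exp \<mu> c) n = \<mu> ^ n * ((c / \<mu>) gchoose n)"
  by (simp add: degenerate_exp_def fps_compose_linear)

text \<open>Spreading \<open>\<mu> ^ n\<close> over the factors of the binomial coefficient gives
  the falling factorial. At \<open>\<mu> = 0\<close> the convention \<open>c / 0 = 0\<close> makes
  the series 1, whereas \<open>degenerate_ff c 0 n\<close> is \<open>c ^ n\<close>.\<close>

lemma fact_mult_degenerate_exp_nth: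
  assumes "\<mu> \<noteq> 0"
  shows "fact n * fps_nth (degenerate_exp \<mu> c) n = degenerate_ff c \<mu> n"
proof -
  have "fact n * fps_nth (degenerate_exp \<mu> c) n
      = \<mu> ^ n * (\<Prod>i<n. c / \<mu> - of_nat i)"
    by (simp add: fps_nth_degenerate_exp gbinomial_mult_fact atLeast0LessThan mult.left_commute)
  also have "\<dots> = (\<Prod>i<n. \<mu> * (c / \<mu> - of_nat i))"
    by (simp add: prod.distrib)
  also have "\<dots> = degenerate_ff c \<mu> n"
    using assms by (simp add: degenerate_ff_def right_diff_distrib mult.commute)
  finally show ?thesis .
qed

text \<open>Substituting $wt$ for $t$ brings the parameters \<open>lam / w\<^sub>1\<close> and
  \<open>lam / w\<^sub>2\<close> to the common value \<open>lam\<close>, at the price of a factor in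
  the exponent.\<close>

lemma degenerate_exp_rescale:
  assumes "w \<noteq> 0"
  shows "degenerate_exp (\<mu> / w) c oo (fps_const w * fps_X) = degenerate_exp \<mu> (w * c)"
  using assms
  by (simp add: fps_eq_iff fps_compose_linear fps_nth_degenerate_exp power_divide mult.commute [of c])

text \<open>For \<open>c = w\<close> and \<open>\<mu> = lam\<close> this is $T_w(N)$ from
  above.\<close>

definition twisted_exp_sum :: "(int \<Rightarrow> 'a::field_char_0) \<Rightarrow> 'a \<Rightarrow> 'a \<Rightarrow> nat \<Rightarrow> 'a fps" where
  "twisted_exp_sum \<chi> \<mu> c N =
     (\<Sum>a<N. (- 1) ^ a * fps_const (\<chi> (int a)) * degenerate_exp \<mu> (c * of_nat a))"

text \<open>The sum splits into \<open>w\<close> blocks of length \<open>d\<close>, which form a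
  geometric progression because \<chi> has period \<open>d\<close>.\<close>

lemma twisted_exp_sum_period:
  assumes "odd d" and "\<And>a b. [a = b] (mod int d) \<Longrightarrow> \<chi> a = \<chi> b"
  shows "twisted_exp_sum \<chi> \<mu> c (d * w) * (degenerate_exp \<mu> (c * of_nat d) + 1)
       = twisted_exp_sum \<chi> \<mu> c d * (1 - (- degenerate_exp \<mu> (c * of_nat d)) ^ w)"
proof -
  \<comment> \<open>The ratio of consecutive blocks: a shift by the odd number \<open>d\<close>
    flips the sign and multiplies the exponential by $E(cd)$.\<close>
  define q where "q = - degenerate_exp \<mu> (c * of_nat d)"
  have block: "(\<Sum>a = m * d..<m * d + d.
        (- 1) ^ a * fps_const (\<chi> (int a)) * degenerate_exp \<mu> (c * of_nat a))
      = q ^ m * twisted_exp_sum \<chi> \<mu> c d" for m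
  proof -
    have "\<chi> (int (a + m * d)) = \<chi> (int a)" for a
      by (rule assms(2)) (simp add: cong_def)
    moreover have "(- 1) ^ (a + m * d) * degenerate_exp \<mu> (c * of_nat (a + m * d))
        = q ^ m * ((- 1) ^ a * degenerate_exp \<mu> (c * of_nat a))" for a
    proof -
      have "degenerate_exp \<mu> (c * of_nat (a + m * d))
          = degenerate_exp \<mu> (c * of_nat a) * degenerate_exp \<mu> (of_nat m * (c * of_nat d))"
        by (simp add: degenerate_exp_add [symmetric] algebra_simps)
      moreover have "(- 1 :: 'a fps) ^ (a + m * d) = (- 1) ^ a * (- 1) ^ m"
        using \<open>odd d\<close> by (simp add: power_add power_mult mult.commute [of m])
      ultimately show ?thesis
        by (simp add: q_def degenerate_exp_of_nat_mult power_minus [of "degenerate_exp _ _"])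
    qed
    ultimately have "(\<Sum>a<d. (- 1) ^ (a + m * d) * fps_const (\<chi> (int (a + m * d)))
          * degenerate_exp \<mu> (c * of_nat (a + m * d)))
        = (\<Sum>a<d. q ^ m * ((- 1) ^ a * fps_const (\<chi> (int a)) * degenerate_exp \<mu> (c * of_nat a)))"
      by (intro sum.cong) (simp_all only: mult_ac)
    then show ?thesis
      using sum.shift_bounds_nat_ivl [of "\<lambda>a. (- 1) ^ a * fps_const (\<chi> (int a))
          * degenerate_exp \<mu> (c * of_nat a)" 0 "m * d" d]
      by (simp only: twisted_exp_sum_def sum_distrib_left atLeast0LessThan add.commute add_0)
  qed
  have "twisted_exp_sum \<chi> \<mu> c (d * w) = (\<Sum>m<w. q ^ m) * twisted_exp_sum \<chi> \<mu> c d"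
    unfolding sum_distrib_right block [symmetric] sum.nat_group
    by (simp add: twisted_exp_sum_def mult.commute)
  \<comment> \<open>The factor $E(cd) + 1$ is \<open>1 - q\<close>, so it closes the geometric sum
    to \<open>1 - q ^ w\<close>.\<close>
  then show ?thesis
    using one_diff_power_eq [of q w]
    by (simp add: q_def mult.assoc mult.left_commute mult.commute [of "twisted_exp_sum _ _ _ _"] add.commute)
qed

lemma degenerate_euler_gf_rescale:
  assumes "w \<noteq> 0"
  shows "degenerate_euler_gf d (\<mu> / w) \<chi> x oo (fps_const w * fps_X)
       = 2 * twisted_exp_sum \<chi> \<mu> w d * inverse (degenerate_exp \<mu> (w * of_nat d) + 1)
           * degenerate_exp \<mu> (w * x)"
proof -
  let ?h = "fps_const w * fps_X"
  \<comment> \<open>The constant term is 2, so the quotient is a product with an inverse, and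
    composition commutes with that inverse.\<close>
  have nz: "fps_nth (degenerate_exp \<nu> c + 1) 0 \<noteq> 0" for \<nu> c :: 'a
    by (simp add: fps_nth_degenerate_exp)
  have "(- 1) ^ a oo ?h = (- 1) ^ a" for a
    by (simp add: minus_one_power_fps)
  then have "(\<Sum>a<d. (- 1) ^ a * fps_const (\<chi> (int a)) * degenerate_exp (\<mu> / w) (of_nat a)) oo ?h
      = twisted_exp_sum \<chi> \<mu> w d"
    by (simp add: twisted_exp_sum_def fps_compose_sum_distrib fps_compose_mult_distrib
        degenerate_exp_rescale [OF assms])
  then show ?thesis
    using nz [of "\<mu> / w" "of_nat d"]
    by (simp add: degenerate_euler_gf_def fps_divide_unit fps_compose_mult_distrib
        fps_inverse_compose fps_compose_add_distrib degenerate_exp_rescale [OF assms])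
qed

lemma alt_char_sum_eq_nth:
  assumes "\<mu> \<noteq> 0" and "w \<noteq> 0" and "N > 0"
  shows "w ^ k * alt_char_sum k (N - 1) (\<mu> / w) \<chi>
       = fact k * fps_nth (2 * twisted_exp_sum \<chi> \<mu> w N) k"
proof -
  have ff: "w ^ k * degenerate_ff c (\<mu> / w) k = fact k * fps_nth (degenerate_exp \<mu> (w * c)) k" for c
    using assms
    by (simp add: fact_mult_degenerate_exp_nth [symmetric] fps_nth_degenerate_exp power_divide
        mult.commute)
  \<comment> \<open>For \<open>N = 0\<close> truncated subtraction would leave the index 0 in the
    left-hand set.\<close>
  have "{0..N - 1} = {..<N}"
    using \<open>N > 0\<close> by auto
  then have "w ^ k * alt_char_sum k (N - 1) (\<mu> / w) \<chi>
      = 2 * (\<Sum>l<N. (- 1) ^ l * \<chi> (int l) * (w ^ k * degenerate_ff (of_nat l) (\<mu> / w) k))"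
    by (simp add: alt_char_sum_def sum_distrib_left mult_ac)
  also have "\<dots> = fact k * fps_nth (2 * twisted_exp_sum \<chi> \<mu> w N) k"
    by (simp add: ff twisted_exp_sum_def minus_one_power_fps fps_sum_nth sum_distrib_left mult_ac
        fps_numeral_fps_const)
  finally show ?thesis .
qed

text \<open>The binomial convolution is a product of exponential generating functions;
  \<open>w\<^sub>1 ^ i\<close> is absorbed by the substitution in the first factor and
  \<open>w\<^sub>2 ^ (l - i)\<close> by the second.\<close>

lemma degenerate_euler_convolution:
  fixes w\<^sub>1 w\<^sub>2 :: nat
  assumes "lam \<noteq> 0" and "w\<^sub>1 > 0" and "w\<^sub>2 > 0" and "d > 0"
  shows "(\<Sum>i=0..l. of_nat (l choose i)
        * degenerate_euler d i (lam / of_nat w\<^sub>1) \<chi> (of_nat w\<^sub>2 * x)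
        * of_nat w\<^sub>1 ^ i * of_nat w\<^sub>2 ^ (l - i)
        * alt_char_sum (l - i) (d * w\<^sub>1 - 1) (lam / of_nat w\<^sub>2) \<chi>)
     = fact l * fps_nth ((degenerate_euler_gf d (lam / of_nat w\<^sub>1) \<chi> (of_nat w\<^sub>2 * x)
            oo (fps_const (of_nat w\<^sub>1) * fps_X))
          * (2 * twisted_exp_sum \<chi> lam (of_nat w\<^sub>2) (d * w\<^sub>1))) l"
    (is "(\<Sum>i=0..l. ?t i) = fact l * fps_nth (?f * ?g) l")
proof -
  have "?t i = fact l * (fps_nth ?f i * fps_nth ?g (l - i))" if "i \<le> l" for i
  proof -
    have "?t i = of_nat (l choose i) * (fact i * fps_nth ?f i)
        * (of_nat w\<^sub>2 ^ (l - i) * alt_char_sum (l - i) (d * w\<^sub>1 - 1) (lam / of_nat w\<^sub>2) \<chi>)"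
      by (simp add: degenerate_euler_def fps_compose_linear mult.assoc mult.left_commute)
    also have "\<dots> = of_nat (l choose i) * (fact i * fps_nth ?f i) * (fact (l - i) * fps_nth ?g (l - i))"
      using assms by (subst alt_char_sum_eq_nth) auto
    also have "\<dots> = (fact i * fact (l - i) * of_nat (l choose i)) * (fps_nth ?f i * fps_nth ?g (l - i))"
      by (simp only: mult_ac)
    also have "fact i * fact (l - i) * of_nat (l choose i) = (fact l :: 'a)"
      using binomial_fact_lemma [OF that] by (metis of_nat_fact of_nat_mult)
    finally show ?thesis .
  qed
  then show ?thesis
    by (simp add: fps_mult_nth sum_distrib_left)
qed

theorem theorem1:
  fixes w\<^sub>1 w\<^sub>2 d l :: nat
    and \<chi> :: "int \<Rightarrow> 'a::field_char_0"
    and lam x :: 'a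
  assumes "[w\<^sub>1 = 1] (mod 2)" and "[w\<^sub>2 = 1] (mod 2)" and "[d = 1] (mod 2)"
    and "dirichlet_character d \<chi>" and "conductor d \<chi> = d"
    and "lam \<noteq> 0"
  shows
    "(\<Sum>i=0..l. of_nat (l choose i)
        * degenerate_euler d i (lam / of_nat w\<^sub>1) \<chi> (of_nat w\<^sub>2 * x)
        * of_nat w\<^sub>1 ^ i * of_nat w\<^sub>2 ^ (l - i)
        * alt_char_sum (l - i) (d * w\<^sub>1 - 1) (lam / of_nat w\<^sub>2) \<chi>)
   = (\<Sum>i=0..l. of_nat (l choose i)
        * degenerate_euler d i (lam / of_nat w\<^sub>2) \<chi> (of_nat w\<^sub>1 * x)
        * of_nat w\<^sub>2 ^ i * of_nat w\<^sub>1 ^ (l - i)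
        * alt_char_sum (l - i) (d * w\<^sub>2 - 1) (lam / of_nat w\<^sub>1) \<chi>)"
proof -
  have odd: "odd w\<^sub>1" "odd w\<^sub>2" "odd d"
    using assms(1-3) by (simp_all add: cong_def odd_iff_mod_2_eq_one)
  then have pos: "w\<^sub>1 > 0" "w\<^sub>2 > 0" "d > 0"
    by (auto elim: oddE)
  have per: "\<And>a b. [a = b] (mod int d) \<Longrightarrow> \<chi> a = \<chi> b"
    using assms(4) by (auto simp: dirichlet_character_def)
  let ?E = "degenerate_exp lam"
  let ?T = "twisted_exp_sum \<chi> lam"
  \<comment> \<open>The periodicity identity solved for the long sum; for odd \<open>v\<close> the
    sign in $1 - (-E)^v$ becomes a plus.\<close>
  have sum: "?T (of_nat w) (d * v)
      = ?T (of_nat w) d * (?E (of_nat (d * w * v)) + 1) * inverse (?E (of_nat w * of_nat d) + 1)"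
    if "odd v" for v w
  proof -
    let ?D = "?E (of_nat w * of_nat d) + 1"
    have "?D * inverse ?D = 1"
      by (rule inverse_mult_eq_1') (simp add: fps_nth_degenerate_exp)
    then have "?T (of_nat w) (d * v) = (?T (of_nat w) (d * v) * ?D) * inverse ?D"
      by (simp only: mult.assoc mult_1_right)
    also have "?T (of_nat w) (d * v) * ?D = ?T (of_nat w) d * (?E (of_nat (d * w * v)) + 1)"
      using twisted_exp_sum_period [of d \<chi> lam "of_nat w" v, OF odd(3) per] that
      by (simp add: degenerate_exp_of_nat_mult [symmetric] mult_ac add.commute)
    finally show ?thesis .
  qed
  \<comment> \<open>Here \<open>a\<close>, \<open>a'\<close> are the sums over one period,
    \<open>b\<close>, \<open>b'\<close> the inverted denominators, \<open>e\<close> is $E(w_1 w_2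
    x)$ and \<open>s\<close> is $E(d w_1 w_2) + 1$.\<close>
  have rearrange: "(2 * a * b * e) * (2 * (a' * s * b')) = (2 * a' * b' * e) * (2 * (a * s * b))"
    for a b a' b' e s :: "'a fps"
    by (simp only: mult_ac)
  have scaled: "(degenerate_euler_gf d (lam / of_nat w\<^sub>1) \<chi> (of_nat w\<^sub>2 * x)
          oo (fps_const (of_nat w\<^sub>1) * fps_X)) * (2 * ?T (of_nat w\<^sub>2) (d * w\<^sub>1))
      = (degenerate_euler_gf d (lam / of_nat w\<^sub>2) \<chi> (of_nat w\<^sub>1 * x)
          oo (fps_const (of_nat w\<^sub>2) * fps_X)) * (2 * ?T (of_nat w\<^sub>1) (d * w\<^sub>2))"
  proof -
    \<comment> \<open>Makes \<open>e\<close> and \<open>s\<close> literally the same term on both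
      sides.\<close>
    have comm: "of_nat w\<^sub>2 * (of_nat w\<^sub>1 * x) = of_nat w\<^sub>1 * (of_nat w\<^sub>2 * x)"
      "d * w\<^sub>1 * w\<^sub>2 = d * w\<^sub>2 * w\<^sub>1"
      by (simp_all only: mult_ac)
    have nz: "(of_nat w\<^sub>1 :: 'a) \<noteq> 0" "(of_nat w\<^sub>2 :: 'a) \<noteq> 0"
      using pos by simp_all
    show ?thesis
      unfolding degenerate_euler_gf_rescale [OF nz(1)] degenerate_euler_gf_rescale [OF nz(2)]
        sum [OF odd(1)] sum [OF odd(2)] comm
      by (rule rearrange)
  qed
  show ?thesis
    unfolding degenerate_euler_convolution [OF assms(6) pos]
      degenerate_euler_convolution [OF assms(6) pos(2,1,3)] scaled ..
qed

end
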